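(* For every derivation $\mathcal D$ in $\mathsf{NgT}^{i}$ with $\mathrm{oa}(\mathcal D)=\Gamma$ and $\mathrm{end}(\mathcal D)=C$ there is a fully normal derivation $\mathcal D'$ in $\mathsf{NgT}^{i}$ with $\mathrm{oa}(\mathcal D')\sqsubseteq\Gamma$ and $\mathrm{end}(\mathcal D')=C$. In particular, if $\mathcal D$ has no open assumptions, neither has $\mathcal D'$.
   Context: Formulae are generated from a countable set of propositional variables by $A ::= p \mid \bot \mid A\land A \mid A\lor A \mid A\to A$. The natural deduction system $\mathsf{NgT}^{i}$. A derivation is a finite tree of formulae grown by the rules below; its topmost formulae are assumptions, each open or discharged by an application of a rule further down. $\mathrm{oa}(\mathcal D)$ is the multiset of open assumptions of $\mathcal D$ and $\mathrm{end}(\mathcal D)$ its end-formula. A single assumption $A$ is a derivation with open assumptions $\{A\}$ and end-formula $A$. A rule that discharges an assumption formula in a subderivation discharges all its open occurrences there; there may be zero (vacuous discharge), one, or several. - $\land\mathrm I$: from $A$ and $B$ infer $A\land B$. - $\lor\mathrm I_1$: from $A$ infer $A\lor B$. $\lor\mathrm I_2$: from $B$ infer $A\lor B$. - $\to\!\mathrm I$: from a derivation of $B$, infer $A\to B$, discharging $A$. - $\land\mathrm E$: from a major premiss $A\land B$ and a minor derivation of $C$, infer $C$, discharging $A$ and $B$ in the minor derivation. - $\lor\mathrm E$: from a major premiss $A\lor B$ and two minor derivations of $C$, infer $C$, discharging $A$ in the first minor derivation and $B$ in the second. - $\to\!\mathrm E$: from a major premiss $A\to B$, a minor derivation of $A$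 (no discharge) and a minor derivation of $C$, infer $C$, discharging $B$ in the latter. - $\bot\mathrm E$: from the (major) premiss $\bot$ infer any formula $C$. A derivation is fully normal if the major premiss of every application of an elimination rule (including the premiss $\bot$ of every application of $\bot\mathrm E$) is an assumption, open or discharged. For multisets, $\Theta\sqsubseteq\Gamma$ ($\Theta$ is subsumed by $\Gamma$) means that every formula occurring in $\Theta$ occurs in $\Gamma$ (multiplicities are ignored). *)

theory Defs
  imports "HOL-Library.Multiset" "HOL-Library.Countable"
begin

datatype 'v fm =
    Atom 'v
  | Falsum
  | Conj "'v fm" "'v fm"
  | Disj "'v fm" "'v fm"
  | Impl "'v fm" "'v fm"

text \<open>
  Trees built from the rules of \<open>NgT\<^sup>i\<close>. Formula arguments carry the information that the
  subtrees do not determine (the other disjunct, the discharged or the inferred formula) and,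
  for the eliminations, the components of the major premiss. The premisses are listed from left
  to right, the major premiss of an elimination coming first. Whether the premisses fit the rule
  is checked by \<open>derivation\<close> below.
\<close>

datatype 'v tree =
    is_Assm: Assm "'v fm"
  | ConjI "'v tree" "'v tree"
  | DisjI1 "'v tree" "'v fm"
  | DisjI2 "'v fm" "'v tree"
  | ImplI "'v fm" "'v tree"
  | ConjE "'v fm" "'v fm" "'v tree" "'v tree"
  | DisjE "'v fm" "'v fm" "'v tree" "'v tree" "'v tree"
  | ImplE "'v fm" "'v fm" "'v tree" "'v tree" "'v tree"
  | FalsumE "'v tree" "'v fm"

primrec end_fm :: "'v tree \<Rightarrow> 'v fm" where
  "end_fm (Assm A) = A"
| "end_fm (ConjI D E) = Conj (end_fm D) (end_fm E)"
| "end_fm (DisjI1 D B) = Disj (end_fm D) B"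
| "end_fm (DisjI2 A D) = Disj A (end_fm D)"
| "end_fm (ImplI A D) = Impl A (end_fm D)"
| "end_fm (ConjE A B D E) = end_fm E"
| "end_fm (DisjE A B D E F) = end_fm E"
| "end_fm (ImplE A B D E F) = end_fm F"
| "end_fm (FalsumE D C) = C"

text \<open>
  A discharge removes all open occurrences of the formula, possibly none.
\<close>

primrec oa :: "'v tree \<Rightarrow> 'v fm multiset" where
  "oa (Assm A) = {#A#}"
| "oa (ConjI D E) = oa D + oa E"
| "oa (DisjI1 D B) = oa D"
| "oa (DisjI2 A D) = oa D"
| "oa (ImplI A D) = {#X \<in># oa D. X \<noteq> A#}"
| "oa (ConjE A B D E) = oa D + {#X \<in># oa E. X \<noteq> A \<and> X \<noteq> B#}"
| "oa (DisjE A B D E F) = oa D + {#X \<in># oa E. X \<noteq> A#} + {#X \<in># oa F. X \<noteq> B#}"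
| "oa (ImplE A B D E F) = oa D + oa E + {#X \<in># oa F. X \<noteq> B#}"
| "oa (FalsumE D C) = oa D"

primrec derivation :: "'v tree \<Rightarrow> bool" where
  "derivation (Assm A) \<longleftrightarrow> True"
| "derivation (ConjI D E) \<longleftrightarrow> derivation D \<and> derivation E"
| "derivation (DisjI1 D B) \<longleftrightarrow> derivation D"
| "derivation (DisjI2 A D) \<longleftrightarrow> derivation D"
| "derivation (ImplI A D) \<longleftrightarrow> derivation D"
| "derivation (ConjE A B D E) \<longleftrightarrow>
     derivation D \<and> derivation E \<and> end_fm D = Conj A B"
| "derivation (DisjE A B D E F) \<longleftrightarrow>
     derivation D \<and> derivation E \<and> derivation F \<and> end_fm D = Disj A B \<and> end_fm E = end_fm F"
| "derivation (ImplE A B D E F) \<longleftrightarrow>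
     derivation D \<and> derivation E \<and> derivation F \<and> end_fm D = Impl A B \<and> end_fm E = A"
| "derivation (FalsumE D C) \<longleftrightarrow> derivation D \<and> end_fm D = Falsum"

text \<open>
  The major premiss is an assumption iff the subtree above it is a single leaf; that leaf may be
  open or discharged further down.
\<close>

primrec fully_normal :: "'v tree \<Rightarrow> bool" where
  "fully_normal (Assm A) \<longleftrightarrow> True"
| "fully_normal (ConjI D E) \<longleftrightarrow> fully_normal D \<and> fully_normal E"
| "fully_normal (DisjI1 D B) \<longleftrightarrow> fully_normal D"
| "fully_normal (DisjI2 A D) \<longleftrightarrow> fully_normal D"
| "fully_normal (ImplI A D) \<longleftrightarrow> fully_normal D"
| "fully_normal (ConjE A B D E) \<longleftrightarrow> is_Assm D \<and> fully_normal E"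
| "fully_normal (DisjE A B D E F) \<longleftrightarrow> is_Assm D \<and> fully_normal E \<and> fully_normal F"
| "fully_normal (ImplE A B D E F) \<longleftrightarrow> is_Assm D \<and> fully_normal E \<and> fully_normal F"
| "fully_normal (FalsumE D C) \<longleftrightarrow> is_Assm D"

definition subsumed :: "'a multiset \<Rightarrow> 'a multiset \<Rightarrow> bool" (infix "\<sqsubseteq>" 50) where
  "\<Theta> \<sqsubseteq> \<Gamma> \<longleftrightarrow> (\<forall>A. A \<in># \<Theta> \<longrightarrow> A \<in># \<Gamma>)"

end

theory Submission
  imports Defs
begin

text \<open>
  An elimination whose major premiss is an assumption is a left rule of the sequent calculus read
  upside down: the major premiss is the principal formula, which stays available, and the
  discharged formulae are the active ones added to the antecedent of the minor premisses. So
  fully normal derivations are the cut-free derivations of an intuitionistic sequent calculus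
  with sets of formulae as antecedents, where weakening and contraction are built in.

  An elimination with an arbitrary major premiss is a left rule followed by a cut on the major
  premiss. Hence every derivation translates into the calculus once cut is admissible
  (\<open>cut\<close>, used in \<open>cut_free_of_derivation\<close>), and cut-free derivations translate
  back into fully normal ones (\<open>fully_normal_of_cut_free\<close>).

  Admissibility of cut is proved by induction on the size of the cut formula. The left rules
  at the end of the first premiss are permuted below the cut until that premiss
  ends in a right rule. For a formula introduced on the right, every use of it as a principal
  formula on the left can be replaced by cuts on its components; \<open>eliminate_antecedent\<close>
  performs this replacement throughout the second premiss.
\<close>

inductive cut_free :: "'v fm set \<Rightarrow> 'v fm \<Rightarrow> bool" (infix "\<turnstile>" 50) where
  Ax: "A \<in> G \<Longrightarrow> G \<turnstile> A"
| ConjR: "G \<turnstile> A \<Longrightarrow> G \<turnstile> B \<Longrightarrow> G \<turnstile> Conj A B"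
| DisjR1: "G \<turnstile> A \<Longrightarrow> G \<turnstile> Disj A B"
| DisjR2: "G \<turnstile> B \<Longrightarrow> G \<turnstile> Disj A B"
| ImplR: "insert A G \<turnstile> B \<Longrightarrow> G \<turnstile> Impl A B"
| ConjL: "Conj A B \<in> G \<Longrightarrow> insert A (insert B G) \<turnstile> C \<Longrightarrow> G \<turnstile> C"
| DisjL: "Disj A B \<in> G \<Longrightarrow> insert A G \<turnstile> C \<Longrightarrow> insert B G \<turnstile> C \<Longrightarrow> G \<turnstile> C"
| ImplL: "Impl A B \<in> G \<Longrightarrow> G \<turnstile> A \<Longrightarrow> insert B G \<turnstile> C \<Longrightarrow> G \<turnstile> C"
| FalsumL: "Falsum \<in> G \<Longrightarrow> G \<turnstile> C"

lemma weakening: "G \<turnstile> C \<Longrightarrow> G \<subseteq> H \<Longrightarrow> H \<turnstile> C"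
proof (induction arbitrary: H rule: cut_free.induct)
  case (ImplR A G B)
  then show ?case by (meson cut_free.ImplR insert_mono)
next
  case (ConjL A B G C)
  then show ?case by (meson cut_free.ConjL insert_mono subsetD)
next
  case (DisjL A B G C)
  then show ?case by (meson cut_free.DisjL insert_mono subsetD)
next
  case (ImplL A B G C)
  then show ?case by (meson cut_free.ImplL insert_mono subsetD)
qed (auto intro: cut_free.intros)


section \<open>Admissibility of cut\<close>

text \<open>
  \<open>left_rule K G\<close> says that the left rule with principal formula \<open>K\<close> is admissible
  at \<open>G\<close> although \<open>K\<close> need not occur in \<open>G\<close>.
\<close>

fun left_rule :: "'v fm \<Rightarrow> 'v fm set \<Rightarrow> bool" where
  "left_rule (Atom p) G \<longleftrightarrow> True"
| "left_rule Falsum G \<longleftrightarrow> (\<forall>C. G \<turnstile> C)"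
| "left_rule (Conj A B) G \<longleftrightarrow> (\<forall>C. insert A (insert B G) \<turnstile> C \<longrightarrow> G \<turnstile> C)"
| "left_rule (Disj A B) G \<longleftrightarrow>
     (\<forall>C. insert A G \<turnstile> C \<longrightarrow> insert B G \<turnstile> C \<longrightarrow> G \<turnstile> C)"
| "left_rule (Impl A B) G \<longleftrightarrow> (\<forall>C. G \<turnstile> A \<longrightarrow> insert B G \<turnstile> C \<longrightarrow> G \<turnstile> C)"

text \<open>
  A derivation can touch an antecedent formula \<open>K\<close> only in an axiom or as the principal
  formula of a left rule, and the two hypotheses on \<open>K\<close> replace exactly these uses. The
  second one ranges over all larger contexts because antecedents grow towards the leaves.
\<close>

lemma eliminate_antecedent:
  assumes "H \<turnstile> C" and "H \<subseteq> insert K G" and "G \<turnstile> K"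
    and "\<And>G'. G \<subseteq> G' \<Longrightarrow> left_rule K G'"
  shows "G \<turnstile> C"
  using assms
proof (induction arbitrary: G rule: cut_free.induct)
  case (Ax A H)
  then show ?case by (auto intro: cut_free.Ax)
next
  case (ConjR H A B)
  then show ?case by (simp add: cut_free.ConjR)
next
  case (DisjR1 H A B)
  then show ?case by (simp add: cut_free.DisjR1)
next
  case (DisjR2 H B A)
  then show ?case by (simp add: cut_free.DisjR2)
next
  case (ImplR A H B)
  have "insert A G \<turnstile> B"
    using ImplR.prems by (intro ImplR.IH) (auto intro: weakening)
  then show ?case by (rule cut_free.ImplR)
next
  case (ConjL A B H C)
  have minor: "insert A (insert B G) \<turnstile> C"
    using ConjL.prems by (intro ConjL.IH) (auto intro: weakening)
  show ?case
  proof (cases "K = Conj A B")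
    case True
    then show ?thesis using minor ConjL.prems(3)[of G] by simp
  next
    case False
    then have "Conj A B \<in> G" using ConjL.hyps ConjL.prems(1) by auto
    then show ?thesis using minor by (rule cut_free.ConjL)
  qed
next
  case (DisjL A B H C)
  have minor: "insert A G \<turnstile> C" "insert B G \<turnstile> C"
    using DisjL.prems by (intro DisjL.IH; auto intro: weakening)+
  show ?case
  proof (cases "K = Disj A B")
    case True
    then show ?thesis using minor DisjL.prems(3)[of G] by simp
  next
    case False
    then have "Disj A B \<in> G" using DisjL.hyps DisjL.prems(1) by auto
    then show ?thesis using minor by (rule cut_free.DisjL)
  qed
next
  case (ImplL A B H C)
  have minor: "G \<turnstile> A" "insert B G \<turnstile> C"
    using ImplL.prems by (intro ImplL.IH; auto intro: weakening)+
  show ?case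
  proof (cases "K = Impl A B")
    case True
    then show ?thesis using minor ImplL.prems(3)[of G] by simp
  next
    case False
    then have "Impl A B \<in> G" using ImplL.hyps ImplL.prems(1) by auto
    then show ?thesis using minor by (rule cut_free.ImplL)
  qed
next
  case (FalsumL H C)
  show ?case
  proof (cases "K = Falsum")
    case True
    then show ?thesis using FalsumL.prems(3)[of G] by simp
  next
    case False
    then have "Falsum \<in> G" using FalsumL.hyps FalsumL.prems(1) by auto
    then show ?thesis by (rule cut_free.FalsumL)
  qed
qed

definition cut_admissible :: "'v fm \<Rightarrow> bool" where
  "cut_admissible A \<longleftrightarrow> (\<forall>G C. G \<turnstile> A \<longrightarrow> insert A G \<turnstile> C \<longrightarrow> G \<turnstile> C)"

lemma cut_admissibleD: "cut_admissible A \<Longrightarrow> G \<turnstile> A \<Longrightarrow> insert A G \<turnstile> C \<Longrightarrow> G \<turnstile> C"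
  by (auto simp: cut_admissible_def)

text \<open>
  Left rules keep the cut formula \<open>A\<close> as the succedent of their (last) premisses and only
  enlarge the antecedent, so the cut can be made there instead; the context \<open>H\<close> of the
  second premiss is allowed to be larger than \<open>G\<close> to follow this growth. Right rules
  make \<open>left_rule A\<close> admissible through cuts on the components of \<open>A\<close>.
\<close>

lemma cut_step:
  fixes A :: "'v fm"
  assumes "G \<turnstile> A" and "\<And>B :: 'v fm. size B < size A \<Longrightarrow> cut_admissible B"
    and "G \<subseteq> H" and "insert A H \<turnstile> C"
  shows "H \<turnstile> C"
  using assms
proof (induction arbitrary: H rule: cut_free.induct)
  case (Ax A G)
  then show ?case by (metis insert_absorb subsetD)
next
  case (ConjR G A B)
  have cuts: "cut_admissible A" "cut_admissible B"
    by (simp_all add: ConjR.prems(1))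
  have left: "left_rule (Conj A B) G'" if "H \<subseteq> G'" for G'
  proof -
    have prems: "insert B G' \<turnstile> A" "G' \<turnstile> B"
      using ConjR.hyps ConjR.prems(2) that by (auto intro: weakening)
    have "G' \<turnstile> E" if "insert A (insert B G') \<turnstile> E" for E
      using cut_admissibleD[OF cuts(2) prems(2) cut_admissibleD[OF cuts(1) prems(1) that]] .
    then show ?thesis by simp
  qed
  have right: "H \<turnstile> Conj A B"
    using ConjR.hyps ConjR.prems(2) by (auto intro: cut_free.ConjR weakening)
  show ?case
    by (rule eliminate_antecedent[OF ConjR.prems(3) subset_refl right left])
next
  case (DisjR1 G A B)
  have cut: "cut_admissible A" by (simp add: DisjR1.prems(1))
  have prem: "G' \<turnstile> A" if "H \<subseteq> G'" for G'
    using that DisjR1.hyps DisjR1.prems(2) by (auto intro: weakening)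
  have left: "left_rule (Disj A B) G'" if "H \<subseteq> G'" for G'
    using cut_admissibleD[OF cut prem[OF that]] by simp
  have right: "H \<turnstile> Disj A B"
    using DisjR1.hyps DisjR1.prems(2) by (auto intro: cut_free.DisjR1 weakening)
  show ?case
    by (rule eliminate_antecedent[OF DisjR1.prems(3) subset_refl right left])
next
  case (DisjR2 G B A)
  have cut: "cut_admissible B" by (simp add: DisjR2.prems(1))
  have prem: "G' \<turnstile> B" if "H \<subseteq> G'" for G'
    using that DisjR2.hyps DisjR2.prems(2) by (auto intro: weakening)
  have left: "left_rule (Disj A B) G'" if "H \<subseteq> G'" for G'
    using cut_admissibleD[OF cut prem[OF that]] by simp
  have right: "H \<turnstile> Disj A B"
    using DisjR2.hyps DisjR2.prems(2) by (auto intro: cut_free.DisjR2 weakening)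
  show ?case
    by (rule eliminate_antecedent[OF DisjR2.prems(3) subset_refl right left])
next
  case (ImplR A G B)
  have cuts: "cut_admissible A" "cut_admissible B"
    by (simp_all add: ImplR.prems(1))
  have body: "insert A G' \<turnstile> B" if "H \<subseteq> G'" for G'
    using that ImplR.hyps ImplR.prems(2) by (auto intro: weakening)
  have left: "left_rule (Impl A B) G'" if "H \<subseteq> G'" for G'
  proof -
    have "G' \<turnstile> E" if "G' \<turnstile> A" and "insert B G' \<turnstile> E" for E
    proof -
      have "G' \<turnstile> B"
        using cuts(1) that(1) body[OF \<open>H \<subseteq> G'\<close>] by (rule cut_admissibleD)
      then show ?thesis using cuts(2) that(2) by (metis cut_admissibleD)
    qed
    then show ?thesis by simp
  qed
  have right: "H \<turnstile> Impl A B"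
    by (rule cut_free.ImplR[OF body[OF subset_refl]])
  show ?case
    by (rule eliminate_antecedent[OF ImplR.prems(3) subset_refl right left])
next
  case (ConjL A B G K)
  have "insert A (insert B H) \<turnstile> C"
  proof (rule ConjL.IH)
    show "insert K (insert A (insert B H)) \<turnstile> C" using ConjL.prems(3) by (rule weakening) auto
  qed (use ConjL.prems(1,2) in auto)
  moreover have "Conj A B \<in> H" using ConjL.hyps(1) ConjL.prems(2) by auto
  ultimately show ?case by (rule cut_free.ConjL[rotated])
next
  case (DisjL A B G K)
  have "insert A H \<turnstile> C"
  proof (rule DisjL.IH(1))
    show "insert K (insert A H) \<turnstile> C" using DisjL.prems(3) by (rule weakening) auto
  qed (use DisjL.prems(1,2) in auto)
  moreover have "insert B H \<turnstile> C"
  proof (rule DisjL.IH(2))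
    show "insert K (insert B H) \<turnstile> C" using DisjL.prems(3) by (rule weakening) auto
  qed (use DisjL.prems(1,2) in auto)
  moreover have "Disj A B \<in> H" using DisjL.hyps(1) DisjL.prems(2) by auto
  ultimately show ?case by (rule cut_free.DisjL[rotated])
next
  case (ImplL A B G K)
  have "insert B H \<turnstile> C"
  proof (rule ImplL.IH(2))
    show "insert K (insert B H) \<turnstile> C" using ImplL.prems(3) by (rule weakening) auto
  qed (use ImplL.prems(1,2) in auto)
  moreover have "H \<turnstile> A" using ImplL.hyps(2) ImplL.prems(2) by (rule weakening)
  moreover have "Impl A B \<in> H" using ImplL.hyps(1) ImplL.prems(2) by auto
  ultimately show ?case using cut_free.ImplL by blast
next
  case (FalsumL G K)
  then show ?case by (auto intro: cut_free.FalsumL)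
qed

lemma cut_admissible: "cut_admissible A"
proof (induction A rule: measure_induct_rule[of size])
  case (less A)
  show ?case
    unfolding cut_admissible_def using cut_step[OF _ less.IH] by blast
qed

lemma cut: "G \<turnstile> A \<Longrightarrow> insert A G \<turnstile> C \<Longrightarrow> G \<turnstile> C"
  using cut_admissible by (rule cut_admissibleD)


section \<open>Natural deduction and the sequent calculus\<close>

lemma cut_free_of_derivation:
  assumes "derivation D" and "set_mset (oa D) \<subseteq> G"
  shows "G \<turnstile> end_fm D"
  using assms
proof (induction D arbitrary: G)
  case (Assm A)
  then show ?case by (simp add: Ax)
next
  case (ConjI D E)
  then show ?case by (simp add: ConjR)
next
  case (DisjI1 D B)
  then show ?case by (simp add: DisjR1)
next
  case (DisjI2 A D)
  then show ?case by (simp add: DisjR2)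
next
  case (ImplI A D)
  have "insert A G \<turnstile> end_fm D" using ImplI.prems by (intro ImplI.IH) auto
  then show ?case by (simp add: ImplR)
next
  case (ConjE A B D E)
  have "G \<turnstile> Conj A B" using ConjE.prems ConjE.IH(1)[of G] by simp
  moreover have "insert A (insert B (insert (Conj A B) G)) \<turnstile> end_fm E"
    using ConjE.prems by (intro ConjE.IH(2)) auto
  then have "insert (Conj A B) G \<turnstile> end_fm E" by (rule ConjL[rotated]) simp
  ultimately have "G \<turnstile> end_fm E" by (rule cut)
  then show ?case by simp
next
  case (DisjE A B D E F)
  have major: "G \<turnstile> Disj A B" using DisjE.prems DisjE.IH(1)[of G] by simp
  have "insert A (insert (Disj A B) G) \<turnstile> end_fm E"
    using DisjE.prems by (intro DisjE.IH(2)) auto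
  moreover have "insert B (insert (Disj A B) G) \<turnstile> end_fm F"
    using DisjE.prems by (intro DisjE.IH(3)) auto
  ultimately have "insert (Disj A B) G \<turnstile> end_fm E"
    using DisjE.prems(1) DisjL[of A B "insert (Disj A B) G" "end_fm E"] by simp
  with major have "G \<turnstile> end_fm E" by (rule cut)
  then show ?case by simp
next
  case (ImplE A B D E F)
  have major: "G \<turnstile> Impl A B" using ImplE.prems ImplE.IH(1)[of G] by simp
  have "insert (Impl A B) G \<turnstile> A"
    using ImplE.prems ImplE.IH(2)[of "insert (Impl A B) G"] by auto
  moreover have "insert B (insert (Impl A B) G) \<turnstile> end_fm F"
    using ImplE.prems by (intro ImplE.IH(3)) auto
  ultimately have "insert (Impl A B) G \<turnstile> end_fm F"
    by (rule ImplL[rotated]) simp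
  with major have "G \<turnstile> end_fm F" by (rule cut)
  then show ?case by simp
next
  case (FalsumE D C)
  have "G \<turnstile> Falsum" using FalsumE.prems FalsumE.IH[of G] by simp
  then have "G \<turnstile> C" by (rule cut) (simp add: FalsumL)
  then show ?case by simp
qed

lemma fully_normal_of_cut_free:
  assumes "G \<turnstile> C"
  shows "\<exists>D. derivation D \<and> fully_normal D \<and> set_mset (oa D) \<subseteq> G \<and> end_fm D = C"
  using assms
proof (induction rule: cut_free.induct)
  case (Ax A G)
  then show ?case by (intro exI[of _ "Assm A"]) simp
next
  case (ConjR G A B)
  then obtain D E where "derivation D" "fully_normal D" "set_mset (oa D) \<subseteq> G" "end_fm D = A"
    "derivation E" "fully_normal E" "set_mset (oa E) \<subseteq> G" "end_fm E = B" by blast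
  then show ?case by (intro exI[of _ "ConjI D E"]) simp
next
  case (DisjR1 G A B)
  then obtain D where "derivation D" "fully_normal D" "set_mset (oa D) \<subseteq> G" "end_fm D = A"
    by blast
  then show ?case by (intro exI[of _ "DisjI1 D B"]) simp
next
  case (DisjR2 G B A)
  then obtain D where "derivation D" "fully_normal D" "set_mset (oa D) \<subseteq> G" "end_fm D = B"
    by blast
  then show ?case by (intro exI[of _ "DisjI2 A D"]) simp
next
  case (ImplR A G B)
  then obtain D where "derivation D" "fully_normal D" "set_mset (oa D) \<subseteq> insert A G"
    "end_fm D = B" by blast
  then show ?case by (intro exI[of _ "ImplI A D"]) auto
next
  case (ConjL A B G C)
  then obtain D where "derivation D" "fully_normal D"
    "set_mset (oa D) \<subseteq> insert A (insert B G)" "end_fm D = C" by blast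
  then show ?case using ConjL.hyps(1)
    by (intro exI[of _ "ConjE A B (Assm (Conj A B)) D"]) auto
next
  case (DisjL A B G C)
  then obtain D E where
    "derivation D" "fully_normal D" "set_mset (oa D) \<subseteq> insert A G" "end_fm D = C"
    "derivation E" "fully_normal E" "set_mset (oa E) \<subseteq> insert B G" "end_fm E = C"
    by blast
  then show ?case using DisjL.hyps(1)
    by (intro exI[of _ "DisjE A B (Assm (Disj A B)) D E"]) auto
next
  case (ImplL A B G C)
  then obtain D E where
    "derivation D" "fully_normal D" "set_mset (oa D) \<subseteq> G" "end_fm D = A"
    "derivation E" "fully_normal E" "set_mset (oa E) \<subseteq> insert B G" "end_fm E = C"
    by blast
  then show ?case using ImplL.hyps(1)
    by (intro exI[of _ "ImplE A B (Assm (Impl A B)) D E"]) auto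
next
  case (FalsumL G C)
  then show ?case by (intro exI[of _ "FalsumE (Assm Falsum) C"]) simp
qed

theorem theorem6p10:
  fixes D :: "'v::countable tree" and \<Gamma> :: "'v fm multiset" and C :: "'v fm"
  assumes "derivation D" and "oa D = \<Gamma>" and "end_fm D = C"
  shows "\<exists>D'. derivation D' \<and> fully_normal D' \<and> oa D' \<sqsubseteq> \<Gamma> \<and> end_fm D' = C \<and>
           (oa D = {#} \<longrightarrow> oa D' = {#})"
proof -
  have "set_mset \<Gamma> \<turnstile> C" using assms cut_free_of_derivation by blast
  then obtain D' where "derivation D'" "fully_normal D'" "set_mset (oa D') \<subseteq> set_mset \<Gamma>"
    "end_fm D' = C" using fully_normal_of_cut_free by blast
  then show ?thesis using assms(2) by (intro exI[of _ D']) (auto simp: subsumed_def)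
qed

end
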